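(* Consider the global-flux-quadrature SUPG method (SUPG-GFQ) for $\partial_t\mathbf W+\nabla\cdot\mathbf F(\mathbf W)=\mathbf S(\mathbf W;\mathbf x)$ on continuous $\mathbb Q^K$ Gauss--Lobatto elements (without boundary conditions). Let $\mathbf f(x^1)$ and $\mathbf g(x^2)$ be arbitrary univariate $\mathbb R^s$-valued functions, with one-dimensional nodal interpolants $\mathbf f_h,\mathbf g_h$ having nodal values $\mathsf f^i_p=\mathbf f(x^1_{i,p})$, $\mathsf g^j_k=\mathbf g(x^2_{j,k})$. Then every discrete function $\mathbf W_h\in(V_h^K)^s$ whose integrated fluxes and source satisfy $$\mathcal F_{1,h}(\mathbf W_h)(\mathbf x)+\mathcal F_{2,h}(\mathbf W_h)(\mathbf x)+\mathcal S_h(\mathbf W_h)(\mathbf x)=\mathbf f_h(x^1)+\mathbf g_h(x^2),$$ or, equivalently, at all nodes, $$(\mathcal F_1)^{ij}_{pk}+(\mathcal F_2)^{ij}_{pk}+\mathcal S^{ij}_{pk}=\mathsf f^i_p+\mathsf g^j_k,$$ is a discrete stationary solution both of the semi-discrete SUPG-GFQ method and of its fully discrete explicit Deferred Correction (DeC) time discretization.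
   Context: Mesh and space. $\Omega=[x^1_0,x^1_0+L_1]\times[x^2_0,x^2_0+L_2]$ is divided into $N_1\times N_2$ elements $E_{ij}=[x^1_i,x^1_{i+1}]\times[x^2_j,x^2_{j+1}]$ with uniform sizes $h_m=L_m/N_m$. Fix $K\ge1$. In every one-dimensional cell take the $K+1$ Gauss--Lobatto points $x^m_{\ell,0}=x^m_\ell<\dots<x^m_{\ell,K}=x^m_{\ell+1}$. $V_h^K$ is the space of continuous functions on $\Omega$ whose restriction to each element is in $\mathbb Q^K$. Its nodes $\mathbf x_\alpha$ are the tensor products of the one-dimensional points, and $\varphi_\alpha$ is the nodal basis. For an array, the sub/superscripts $^{ij}_{pk}$ denote the value at node $(x^1_{i,p},x^2_{j,k})$. Potentials. For $\mathbf W_h$ with nodal values $\mathbf W_\alpha$, $\mathbf F_{m,h}$ and $\mathbf S_h$ are the nodal interpolants in $(V_h^K)^s$ of $\mathbf F_m(\mathbf W_\alpha)$ and $\mathbf S(\mathbf W_\alpha;\mathbf x_\alpha)$. $\mathcal F_{1,h},\mathcal F_{2,h},\mathcal S_h\in(V_h^K)^s$ are defined by their values at every node $(a,b)$: $\mathcal F_{1,h}(a,b)=\int_{x^2_0}^{b}\mathbf F_{1,h}(a,\eta)d\eta$, $\mathcal F_{2,h}(a,b)=\int_{x^1_0}^{a}\mathbf F_{2,h}(\xi,b)d\xi$, $\mathcal S_h(a,b)=-\int_{x^1_0}^{a}\int_{x^2_0}^{b}\mathbf S_h\,d\eta d\xi$. Semi-discrete SUPG-GFQ method. For all nodes $\alpha$,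 $$\int_\Omega(\varphi_\alpha+\nabla\varphi_\alpha\cdot\mathbf J\tau)\frac{d\mathbf W_h}{dt}d\mathbf x+[\mathsf R_h]_\alpha+[\mathsf{ST}_h]_\alpha=0,$$ $$[\mathsf R_h]_\alpha=\int_\Omega\varphi_\alpha\,\partial_{x^1}\partial_{x^2}(\mathcal F_{1,h}+\mathcal F_{2,h}+\mathcal S_h)d\mathbf x,\quad [\mathsf{ST}_h]_\alpha=\sum_{E_{ij}}\int_{E_{ij}}\nabla\varphi_\alpha\cdot\mathbf J\tau\,\partial_{x^1}\partial_{x^2}(\mathcal F_{1,h}+\mathcal F_{2,h}+\mathcal S_h)d\mathbf x,$$ with element-wise derivatives and integrals evaluated by the tensor Gauss--Lobatto quadrature at the element nodes. Here $\nabla\varphi\cdot\mathbf J\tau=\partial_{x^1}\varphi\,\mathbf J_1\tau+\partial_{x^2}\varphi\,\mathbf J_2\tau$, $\mathbf J_m=\partial\mathbf F_m/\partial\mathbf W$, and $\tau$ is an $s\times s$ matrix depending on $\mathbf W$ and the mesh. Write $\mathsf M$ for the (diagonal) matrix of $\int\varphi_\alpha\varphi_\beta$ and $M^{\mathsf{SU}}(\mathrm W)$ for the matrix of $\int\nabla\varphi_\alpha\cdot\mathbf J\tau\,\varphi_\beta$ under this quadrature. DeC time discretization. In $[t_n,t_{n+1}]$ with $\Delta t=t_{n+1}-t_n$, take nodes $t_n=t^0<\dots<t^M=t_{n+1}$ with degree-$M$ Lagrange basis $\gamma_r$ and $\theta^m_r=\frac1{\Delta t}\int_{t^0}^{t^m}\gamma_r\,dt$.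 Starting from $\mathrm W^{m,(0)}=\mathrm W^n$ for all $m$, with $\mathrm W^{0,(k)}=\mathrm W^n$ for all $k$, iterate for $k=1,\dots,\kappa$, $m=1,\dots,M$: $$\mathrm W^{m,(k)}=\mathrm W^n-\Delta t\sum_{r=0}^M\theta^m_r\mathsf M^{-1}\Big\{M^{\mathsf{SU}}(\mathrm W^{r,(k-1)})\tfrac{d\mathrm W^{(k-1)}(t^r)}{dt}+\mathsf R_h(\mathrm W^{r,(k-1)})+\mathsf{ST}_h(\mathrm W^{r,(k-1)})\Big\},$$ where $\mathrm W^{(k-1)}(t)=\sum_m\gamma_m(t)\mathrm W^{m,(k-1)}$, and $\mathrm W^{n+1}=\mathrm W^{M,(\kappa)}$. "Discrete stationary solution" means that $\mathsf R_h(\mathbf W_h)=0$ and $\mathsf{ST}_h(\mathbf W_h)=0$, so that constant-in-time $\mathbf W_h$ solves the semi-discrete method, and that $\mathrm W^n=\mathrm W$ gives $\mathrm W^{n+1}=\mathrm W^n$ in the DeC scheme. *)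

theory Defs
  imports "HOL-Analysis.Analysis" "HOL-Computational_Algebra.Polynomial"
begin

section \<open>Gauss--Lobatto points and Lagrange polynomials\<close>

text \<open>Legendre polynomials by the Rodrigues formula.\<close>

definition legendre :: "nat \<Rightarrow> real poly" where
  "legendre K = smult (1 / (2 ^ K * fact K)) ((pderiv ^^ K) ([:-1, 0, 1:] ^ K))"

definition gl_points :: "nat \<Rightarrow> real set" where
  "gl_points K = {-1, 1} \<union> {x. poly (pderiv (legendre K)) x = 0}"

definition gl :: "nat \<Rightarrow> nat \<Rightarrow> real" where
  "gl K p = sorted_list_of_set (gl_points K) ! p"

definition lagrange_basis :: "nat \<Rightarrow> (nat \<Rightarrow> real) \<Rightarrow> nat \<Rightarrow> real \<Rightarrow> real" where
  "lagrange_basis n y r t = (\<Prod>l\<in>{..n} - {r}. (t - y l) / (y r - y l))"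

definition gl_weight :: "nat \<Rightarrow> nat \<Rightarrow> real" where
  "gl_weight K p = integral {-1..1} (lagrange_basis K (gl K) p)"

lemma rolle_roots:
  fixes p :: "real poly"
  assumes "finite A" "card A = Suc n" "\<forall>x\<in>A. poly p x = 0"
  shows "\<exists>B. finite B \<and> card B = n \<and> (\<forall>x\<in>B. poly (pderiv p) x = 0 \<and> Min A < x \<and> x < Max A)"
  using assms
proof (induction n arbitrary: A)
  case 0
  then show ?case by (intro exI[of _ "{}"]) auto
next
  case (Suc n)
  define A' where "A' = A - {Max A}"
  have ne: "A \<noteq> {}" using Suc.prems by auto
  have MA: "Max A \<in> A" using Suc.prems ne by simp
  have fin: "finite A'" and cA: "card A' = Suc n"
    using Suc.prems MA by (auto simp: A'_def)
  have ne': "A' \<noteq> {}" using cA by auto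
  obtain B where B: "finite B" "card B = n"
    "\<forall>x\<in>B. poly (pderiv p) x = 0 \<and> Min A' < x \<and> x < Max A'"
    using Suc.IH[OF fin cA] Suc.prems by (auto simp: A'_def)
  have mA': "Max A' \<in> A" "Max A' \<noteq> Max A" using Max_in[OF fin ne'] by (auto simp: A'_def)
  have lt: "Max A' < Max A" using mA' Max_ge[OF Suc.prems(1)] by (simp add: less_le)
  have mi: "Min A \<le> Min A'" using Min_antimono[of A' A] ne' Suc.prems(1) by (auto simp: A'_def)
  have mi2: "Min A' \<le> Max A'" using fin ne' by simp
  obtain z where z: "Max A' < z" "z < Max A" "poly p (Max A) - poly p (Max A') = (Max A - Max A') * poly (pderiv p) z"
    using poly_MVT[OF lt, of p] by blast
  have pz: "poly (pderiv p) z = 0" using z lt Suc.prems(3) mA' MA by auto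
  have "z \<notin> B" using B z by force
  moreover have "\<forall>x\<in>insert z B. poly (pderiv p) x = 0 \<and> Min A < x \<and> x < Max A"
  proof
    fix x assume "x \<in> insert z B"
    then show "poly (pderiv p) x = 0 \<and> Min A < x \<and> x < Max A"
    proof
      assume "x = z" then show ?thesis using z pz mi mi2 by simp
    next
      assume "x \<in> B"
      then have "poly (pderiv p) x = 0" "Min A' < x" "x < Max A'" using B by auto
      then show ?thesis using mi lt by simp
    qed
  qed
  ultimately show ?case using B
    by (intro exI[of _ "insert z B"]) auto
qed

lemma rodrigues_factor:
  "j \<le> K \<Longrightarrow> ([:-1, 0, 1::real:] ^ (K - j)) dvd (pderiv ^^ j) ([:-1, 0, 1:] ^ K)"
proof (induction j)
  case (Suc j)
  then obtain r where r: "(pderiv ^^ j) ([:-1, 0, 1::real:] ^ K) = [:-1, 0, 1:] ^ (K - j) * r"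
    by (auto elim: dvdE)
  have e: "K - j = Suc (K - Suc j)" using Suc.prems by simp
  have "q ^ m dvd pderiv (q ^ Suc m * r)" for q :: "real poly" and m
  proof -
    have "pderiv (q ^ Suc m * r) = q ^ Suc m * pderiv r + r * (smult (of_nat (Suc m)) (q ^ m) * pderiv q)"
      by (simp only: pderiv_mult pderiv_power_Suc)
    also have "\<dots> = q ^ m * (q * pderiv r) + q ^ m * (r * smult (of_nat (Suc m)) (pderiv q))"
      by (simp only: mult_smult_left mult_smult_right power_Suc ac_simps)
    finally have "pderiv (q ^ Suc m * r) = q ^ m * (q * pderiv r + r * smult (of_nat (Suc m)) (pderiv q))"
      by (simp only: distrib_left)
    then show ?thesis by simp
  qed
  then show ?case unfolding funpow.simps comp_def r e .
qed simp

lemma rodrigues_roots: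
  "j \<le> K \<Longrightarrow> \<exists>B. finite B \<and> card B = j \<and>
     (\<forall>x\<in>B. poly ((pderiv ^^ j) ([:-1, 0, 1::real:] ^ K)) x = 0 \<and> -1 < x \<and> x < 1)"
proof (induction j)
  case 0 then show ?case by (intro exI[of _ "{}"]) auto
next
  case (Suc j)
  then obtain B where B: "finite B" "card B = j"
    "\<forall>x\<in>B. poly ((pderiv ^^ j) ([:-1, 0, 1::real:] ^ K)) x = 0 \<and> -1 < x \<and> x < 1" by auto
  define p where "p = (pderiv ^^ j) ([:-1, 0, 1::real:] ^ K)"
  have "K - j = Suc (K - Suc j)" using Suc.prems by simp
  then have "[:-1, 0, 1::real:] dvd [:-1, 0, 1:] ^ (K - j)" by (simp only: power_Suc dvd_triv_left)
  then have d: "[:-1, 0, 1::real:] dvd p"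
    using rodrigues_factor[of j K] Suc.prems unfolding p_def by (meson dvd_trans Suc_leD)
  then obtain s where s: "p = [:-1, 0, 1::real:] * s" by (elim dvdE)
  have r1: "poly p 1 = 0" "poly p (-1) = 0" unfolding s poly_mult by simp_all
  define A where "A = insert (-1) (insert 1 B)"
  have fA: "finite A" unfolding A_def using B by simp
  have "1 \<notin> B" "-1 \<notin> insert 1 B" using B(3) by auto
  then have c: "card A = Suc (Suc j)" using B(1,2) by (simp add: A_def)
  have "Min A = -1" by (rule Min_eqI[OF fA]) (use B(3) in \<open>auto simp: A_def intro: less_imp_le\<close>)
  moreover have "Max A = 1" by (rule Max_eqI[OF fA]) (use B(3) in \<open>auto simp: A_def intro: less_imp_le\<close>)
  moreover have "\<forall>x\<in>A. poly p x = 0" using r1 B(3) by (simp add: A_def p_def)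
  ultimately show ?case using rolle_roots[OF fA c, of p] by (simp add: p_def)
qed

lemma degree_rodrigues: "degree ((pderiv ^^ j) ([:-1, 0, 1::real:] ^ K)) = 2 * K - j"
  by (induction j) (auto simp: degree_pderiv degree_power_eq)

lemma gl_points_card:
  assumes K: "K \<ge> 1"
  shows "finite (gl_points K) \<and> card (gl_points K) = Suc K \<and> Min (gl_points K) = -1 \<and> Max (gl_points K) = 1"
proof -
  define q where "q = (pderiv ^^ K) ([:-1, 0, 1::real:] ^ K)"
  define Z where "Z = {x. poly (pderiv q) x = 0}"
  have Z: "gl_points K = insert (-1) (insert 1 Z)"
    unfolding gl_points_def legendre_def Z_def q_def by (auto simp: pderiv_smult)
  have dq: "degree q = K" unfolding q_def degree_rodrigues by simp
  then have nz: "pderiv q \<noteq> 0" using K by (auto simp: pderiv_eq_0_iff)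
  then have finZ: "finite Z" unfolding Z_def by (rule poly_roots_finite)
  have cZ: "card Z \<le> K - 1" using card_poly_roots_bound[OF nz] dq by (simp add: Z_def degree_pderiv)
  obtain B where B: "finite B" "card B = K" "\<forall>x\<in>B. poly q x = 0 \<and> -1 < x \<and> x < 1"
    using rodrigues_roots[of K K] unfolding q_def by auto
  then obtain C where C: "finite C" "card C = K - 1"
    "\<forall>x\<in>C. poly (pderiv q) x = 0 \<and> Min B < x \<and> x < Max B"
    using rolle_roots[of B "K - 1" q] K by auto
  have "B \<noteq> {}" using B K by auto
  then have MB: "-1 < Min B" "Max B < 1" using B by auto
  have "C \<subseteq> Z" using C by (auto simp: Z_def)
  then have "C = Z" using C cZ finZ by (metis card_seteq)
  then have Zi: "\<forall>x\<in>Z. -1 < x \<and> x < 1" "card Z = K - 1" using C MB by auto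
  have "card (insert (-1) (insert 1 Z)) = Suc K"
    using Zi finZ K by (subst card_insert_disjoint; auto)+
  moreover have "Min (insert (-1) (insert 1 Z)) = -1" "Max (insert (-1) (insert 1 Z)) = 1"
    using finZ Zi by (intro Min_eqI Max_eqI; force)+
  ultimately show ?thesis unfolding Z using finZ by auto
qed

lemma gl_strict_mono: "K \<ge> 1 \<Longrightarrow> strict_mono_on {..K} (gl K)"
  using gl_points_card[of K] unfolding gl_def
  by (intro strict_mono_onI)
     (auto intro!: sorted_wrt_nth_less[of "(<)"] simp: less_Suc_eq_le)

lemma gl_first: assumes "K \<ge> 1" shows "gl K 0 = -1"
proof -
  have "gl_points K \<noteq> {}" by (auto simp: gl_points_def)
  then show ?thesis using gl_points_card[OF assms] unfolding gl_def
    by (simp add: sorted_list_of_set_nonempty)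
qed

lemma gl_last: assumes K: "K \<ge> 1" shows "gl K K = 1"
proof -
  note G = gl_points_card[OF K]
  let ?l = "sorted_list_of_set (gl_points K)"
  have len: "length ?l = Suc K" "set ?l = gl_points K" using G by auto
  have "1 \<in> set ?l" using len by (auto simp: gl_points_def)
  then obtain i where i: "i < Suc K" "?l ! i = 1" using len by (metis in_set_conv_nth)
  have "?l ! i \<le> ?l ! K" using i len by (intro sorted_nth_mono) auto
  moreover have "?l ! K \<in> gl_points K" using len by (metis nth_mem lessI)
  then have "?l ! K \<le> 1" using G by (metis Max_ge)
  ultimately show ?thesis using i by (simp add: gl_def)
qed

lemma lagrange_basis_delta:
  assumes "strict_mono_on {..n} y" "r \<le> n" "m \<le> n"
  shows "lagrange_basis n y r (y m) = of_bool (r = m)"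
proof (cases "r = m")
  case True
  have "y r - y l \<noteq> 0" if "l \<in> {..n} - {r}" for l
    using strict_mono_on_eqD[OF assms(1), of r l] that assms by auto
  then show ?thesis using True unfolding lagrange_basis_def by (auto intro!: prod.neutral)
next
  case False
  then show ?thesis using assms unfolding lagrange_basis_def by (auto intro!: prod_zero)
qed



section \<open>Mesh\<close>

record axis =
  start :: real
  len :: real
  cells :: nat

record mesh =
  ax1 :: axis
  ax2 :: axis
  deg :: nat

definition valid_axis :: "axis \<Rightarrow> bool" where
  "valid_axis X \<longleftrightarrow> len X > 0 \<and> cells X \<ge> 1"

definition valid_mesh :: "mesh \<Rightarrow> bool" where
  "valid_mesh G \<longleftrightarrow> valid_axis (ax1 G) \<and> valid_axis (ax2 G) \<and> deg G \<ge> 1"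

definition step :: "axis \<Rightarrow> real" where
  "step X = len X / real (cells X)"

definition vertex :: "axis \<Rightarrow> nat \<Rightarrow> real" where
  "vertex X i = start X + real i * step X"

definition cell :: "axis \<Rightarrow> nat \<Rightarrow> real set" where
  "cell X i = {vertex X i .. vertex X (Suc i)}"

definition cell_node :: "nat \<Rightarrow> axis \<Rightarrow> nat \<Rightarrow> nat \<Rightarrow> real" where
  "cell_node K X i p = vertex X i + step X * ((1 + gl K p) / 2)"

text \<open>Global numbering of the one-dimensional nodes: point \<open>p\<close> of cell \<open>i\<close> has number
  \<open>i * K + p\<close>, so that the last point of a cell and the first point of the next one
  share their number.\<close>

definition node :: "nat \<Rightarrow> axis \<Rightarrow> nat \<Rightarrow> real" where
  "node K X a = cell_node K X (a div K) (a mod K)"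

definition domain :: "mesh \<Rightarrow> (real \<times> real) set" where
  "domain G = {start (ax1 G) .. start (ax1 G) + len (ax1 G)} \<times>
              {start (ax2 G) .. start (ax2 G) + len (ax2 G)}"

definition element :: "mesh \<Rightarrow> nat \<Rightarrow> nat \<Rightarrow> (real \<times> real) set" where
  "element G i j = cell (ax1 G) i \<times> cell (ax2 G) j"

definition nodes :: "mesh \<Rightarrow> (nat \<times> nat) set" where
  "nodes G = {..cells (ax1 G) * deg G} \<times> {..cells (ax2 G) * deg G}"

definition point :: "mesh \<Rightarrow> nat \<times> nat \<Rightarrow> real \<times> real" where
  "point G \<alpha> = (node (deg G) (ax1 G) (fst \<alpha>), node (deg G) (ax2 G) (snd \<alpha>))"

definition elem_index :: "mesh \<Rightarrow> nat \<Rightarrow> nat \<Rightarrow> nat \<Rightarrow> nat \<Rightarrow> nat \<times> nat" where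
  "elem_index G i j p q = (i * deg G + p, j * deg G + q)"

definition elem_point :: "mesh \<Rightarrow> nat \<Rightarrow> nat \<Rightarrow> nat \<Rightarrow> nat \<Rightarrow> real \<times> real" where
  "elem_point G i j p q = (cell_node (deg G) (ax1 G) i p, cell_node (deg G) (ax2 G) j q)"


section \<open>The finite element space and its nodal basis\<close>

definition fe_space :: "mesh \<Rightarrow> (real \<times> real \<Rightarrow> real) set" where
  "fe_space G = {u. continuous_on (domain G) u \<and>
     (\<forall>i<cells (ax1 G). \<forall>j<cells (ax2 G). \<exists>c :: nat \<Rightarrow> nat \<Rightarrow> real. \<forall>x\<in>element G i j.
        u x = (\<Sum>p\<le>deg G. \<Sum>q\<le>deg G. c p q * fst x ^ p * snd x ^ q))}"

definition fe_space_vec :: "mesh \<Rightarrow> (real \<times> real \<Rightarrow> real ^ 's) set" where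
  "fe_space_vec G = {u. \<forall>c. (\<lambda>x. u x $ c) \<in> fe_space G}"

text \<open>Of the two cells meeting at an interior vertex, \<open>cell_of\<close> selects the right one;
  the nodal basis functions do not depend on this choice because they are continuous.\<close>

definition cell_of :: "axis \<Rightarrow> real \<Rightarrow> nat" where
  "cell_of X x = min (cells X - 1) (nat \<lfloor>(x - start X) / step X\<rfloor>)"

definition basis1 :: "nat \<Rightarrow> axis \<Rightarrow> nat \<Rightarrow> real \<Rightarrow> real" where
  "basis1 K X a x = (let i = cell_of X x in
     if i * K \<le> a \<and> a \<le> Suc i * K then lagrange_basis K (cell_node K X i) (a - i * K) x else 0)"

definition interp1 :: "nat \<Rightarrow> axis \<Rightarrow> (nat \<Rightarrow> 'v::real_vector) \<Rightarrow> real \<Rightarrow> 'v" where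
  "interp1 K X v x = (\<Sum>a\<le>cells X * K. basis1 K X a x *\<^sub>R v a)"

definition basis :: "mesh \<Rightarrow> nat \<times> nat \<Rightarrow> real \<times> real \<Rightarrow> real" where
  "basis G \<alpha> x = basis1 (deg G) (ax1 G) (fst \<alpha>) (fst x) * basis1 (deg G) (ax2 G) (snd \<alpha>) (snd x)"

definition interp :: "mesh \<Rightarrow> (nat \<times> nat \<Rightarrow> 'v::real_vector) \<Rightarrow> real \<times> real \<Rightarrow> 'v" where
  "interp G v x = (\<Sum>\<alpha>\<in>nodes G. basis G \<alpha> x *\<^sub>R v \<alpha>)"

definition nodal_values :: "mesh \<Rightarrow> (real \<times> real \<Rightarrow> 'v) \<Rightarrow> nat \<times> nat \<Rightarrow> 'v" where
  "nodal_values G u \<alpha> = u (point G \<alpha>)"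

lemma step_pos: "valid_axis X \<Longrightarrow> step X > 0"
  by (simp add: valid_axis_def step_def)

lemma cell_node_mono:
  assumes "valid_axis X" "K \<ge> 1"
  shows "strict_mono_on {..K} (cell_node K X i)"
  using gl_strict_mono[OF assms(2)] step_pos[OF assms(1)]
  unfolding cell_node_def strict_mono_on_def by auto

lemma cell_node_first: "K \<ge> 1 \<Longrightarrow> cell_node K X i 0 = vertex X i"
  by (simp add: cell_node_def gl_first)

lemma cell_node_last: "K \<ge> 1 \<Longrightarrow> cell_node K X i K = vertex X (Suc i)"
  by (simp add: cell_node_def gl_last vertex_def algebra_simps)

lemma cell_node_in_cell:
  assumes "valid_axis X" "K \<ge> 1" "p \<le> K"
  shows "cell_node K X i p \<in> cell X i"
  using strict_mono_on_leD[OF cell_node_mono[OF assms(1,2), of i], of 0 p]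
    strict_mono_on_leD[OF cell_node_mono[OF assms(1,2), of i], of p K] assms
  by (auto simp: cell_def cell_node_first cell_node_last)

lemma node_eq_cell_node:
  assumes "K \<ge> 1" "p \<le> K"
  shows "node K X (i * K + p) = cell_node K X i p"
proof (cases "p = K")
  case True
  have "i * K + K = Suc i * K" by simp
  then have "(i * K + K) div K = Suc i" "(i * K + K) mod K = 0"
    using assms(1) by (simp_all only: nonzero_mult_div_cancel_right mod_mult_self2_is_0)
  then show ?thesis using assms True
    by (simp add: node_def cell_node_first cell_node_last)
next
  case False
  then show ?thesis using assms by (simp add: node_def)
qed

lemma basis1_cell:
  assumes X: "valid_axis X" and K: "K \<ge> 1" and i: "i < cells X" and x: "x \<in> cell X i"
  shows "basis1 K X a x =
    (if i * K \<le> a \<and> a \<le> Suc i * K then lagrange_basis K (cell_node K X i) (a - i * K) x else 0)"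
proof (cases "x = vertex X (Suc i) \<and> Suc i < cells X")
  case False
  have "cell_of X x = i"
  proof -
    let ?y = "(x - start X) / step X"
    have y: "real i \<le> ?y" "?y \<le> real i + 1"
      using x step_pos[OF X] by (auto simp: cell_def vertex_def field_simps)
    show ?thesis
    proof (cases "x = vertex X (Suc i)")
      case True
      then have "cells X = Suc i" using False i by auto
      moreover have "?y = real (Suc i)" using True step_pos[OF X] by (simp add: vertex_def)
      ultimately show ?thesis by (simp add: cell_of_def floor_eq_iff)
    next
      case False
      then have "?y \<noteq> real i + 1" using step_pos[OF X] by (auto simp: vertex_def field_simps)
      then have "\<lfloor>?y\<rfloor> = int i" using y by (intro floor_unique) auto
      then show ?thesis using i by (simp add: cell_of_def)
    qed
  qed
  then show ?thesis by (simp add: basis1_def)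
next
  case True
  let ?L = "\<lambda>i p. lagrange_basis K (cell_node K X i) p x"
  have "(x - start X) / step X = real (Suc i)" using True step_pos[OF X] by (simp add: vertex_def)
  then have "nat \<lfloor>(x - start X) / step X\<rfloor> = Suc i"
    by (simp only: floor_of_nat nat_int)
  then have c: "cell_of X x = Suc i" using True by (simp only: cell_of_def) linarith
  have l: "?L i p = of_bool (p = K)" if "p \<le> K" for p
    using lagrange_basis_delta[OF cell_node_mono[OF X K, of i], of p K] that True
    by (simp add: cell_node_last[OF K])
  have r: "?L (Suc i) p = of_bool (p = 0)" if "p \<le> K" for p
    using lagrange_basis_delta[OF cell_node_mono[OF X K, of "Suc i"], of p 0] that True
    by (simp add: cell_node_first[OF K])
  have "basis1 K X a x = of_bool (a = Suc i * K)"
    unfolding basis1_def Let_def c using r[of "a - Suc i * K"] by auto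
  moreover have "(if i * K \<le> a \<and> a \<le> Suc i * K then ?L i (a - i * K) else 0) = of_bool (a = Suc i * K)"
    using l[of "a - i * K"] K by auto
  ultimately show ?thesis by simp
qed

lemma basis1_delta:
  assumes X: "valid_axis X" and K: "K \<ge> 1" and a: "a \<le> cells X * K" and b: "b \<le> cells X * K"
  shows "basis1 K X a (node K X b) = of_bool (a = b)"
proof -
  obtain i p where ip: "i < cells X" "p \<le> K" "b = i * K + p"
  proof (cases "b = cells X * K")
    case True
    have "cells X \<ge> 1" using X by (simp add: valid_axis_def)
    then obtain c where "cells X = Suc c" by (cases "cells X") auto
    then show ?thesis using True that[of c K] by auto
  next
    case False
    then have "b div K < cells X" using b K by (simp add: less_mult_imp_div_less)
    then show ?thesis using K that[of "b div K" "b mod K"] by (simp add: less_imp_le)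
  qed
  have n: "node K X b = cell_node K X i p" using ip node_eq_cell_node[OF K] by simp
  show ?thesis
  proof (cases "i * K \<le> a \<and> a \<le> Suc i * K")
    case True
    then have "a - i * K \<le> K" by auto
    then show ?thesis unfolding n basis1_cell[OF X K ip(1) cell_node_in_cell[OF X K ip(2)]]
      using True lagrange_basis_delta[OF cell_node_mono[OF X K, of i] _ ip(2), of "a - i * K"] ip
      by auto
  next
    case False
    then show ?thesis unfolding n basis1_cell[OF X K ip(1) cell_node_in_cell[OF X K ip(2)]]
      using ip by auto
  qed
qed

lemma basis_delta:
  assumes "valid_mesh G" "\<alpha> \<in> nodes G" "\<beta> \<in> nodes G"
  shows "basis G \<alpha> (point G \<beta>) = of_bool (\<alpha> = \<beta>)"
  using assms by (cases \<alpha>; cases \<beta>)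
    (simp add: basis_def point_def nodes_def valid_mesh_def basis1_delta)



section \<open>Element-wise derivatives and quadrature\<close>

text \<open>At points of the element boundary these are one-sided derivatives, taken from inside
  the element.\<close>

definition elem_dx1 :: "mesh \<Rightarrow> nat \<Rightarrow> (real \<times> real \<Rightarrow> 'v::real_normed_vector) \<Rightarrow> real \<times> real \<Rightarrow> 'v" where
  "elem_dx1 G i u x = vector_derivative (\<lambda>\<xi>. u (\<xi>, snd x)) (at (fst x) within cell (ax1 G) i)"

definition elem_dx2 :: "mesh \<Rightarrow> nat \<Rightarrow> (real \<times> real \<Rightarrow> 'v::real_normed_vector) \<Rightarrow> real \<times> real \<Rightarrow> 'v" where
  "elem_dx2 G j u x = vector_derivative (\<lambda>\<eta>. u (fst x, \<eta>)) (at (snd x) within cell (ax2 G) j)"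

definition elem_dx12 :: "mesh \<Rightarrow> nat \<Rightarrow> nat \<Rightarrow> (real \<times> real \<Rightarrow> 'v::real_normed_vector) \<Rightarrow> real \<times> real \<Rightarrow> 'v" where
  "elem_dx12 G i j u = elem_dx1 G i (elem_dx2 G j u)"

text \<open>The integrand is given by its values at the local node \<open>(p, q)\<close> of element \<open>(i, j)\<close>;
  it may be discontinuous across element boundaries.\<close>

definition quad_elem :: "mesh \<Rightarrow> nat \<Rightarrow> nat \<Rightarrow> (nat \<Rightarrow> nat \<Rightarrow> 'v::real_vector) \<Rightarrow> 'v" where
  "quad_elem G i j v = (\<Sum>p\<le>deg G. \<Sum>q\<le>deg G.
     (step (ax1 G) / 2 * gl_weight (deg G) p * (step (ax2 G) / 2 * gl_weight (deg G) q)) *\<^sub>R v p q)"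

definition quad :: "mesh \<Rightarrow> (nat \<Rightarrow> nat \<Rightarrow> nat \<Rightarrow> nat \<Rightarrow> 'v::real_vector) \<Rightarrow> 'v" where
  "quad G v = (\<Sum>i<cells (ax1 G). \<Sum>j<cells (ax2 G). quad_elem G i j (v i j))"


section \<open>The balance law and the integrated fluxes and source\<close>

text \<open>\<open>tau P W i j x\<close> is the stabilization matrix at the point \<open>x\<close> of element \<open>(i, j)\<close>
  for the discrete function \<open>W\<close>.\<close>

record ('s::finite) balance_law =
  flux1 :: "real ^ 's \<Rightarrow> real ^ 's"
  flux2 :: "real ^ 's \<Rightarrow> real ^ 's"
  source :: "real ^ 's \<Rightarrow> real \<times> real \<Rightarrow> real ^ 's"
  tau :: "(real \<times> real \<Rightarrow> real ^ 's) \<Rightarrow> nat \<Rightarrow> nat \<Rightarrow> real \<times> real \<Rightarrow> real ^ 's ^ 's"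

definition flux1_h :: "mesh \<Rightarrow> ('s::finite) balance_law \<Rightarrow> (nat \<times> nat \<Rightarrow> real ^ 's) \<Rightarrow> real \<times> real \<Rightarrow> real ^ 's" where
  "flux1_h G P W = interp G (\<lambda>\<alpha>. flux1 P (W \<alpha>))"

definition flux2_h :: "mesh \<Rightarrow> ('s::finite) balance_law \<Rightarrow> (nat \<times> nat \<Rightarrow> real ^ 's) \<Rightarrow> real \<times> real \<Rightarrow> real ^ 's" where
  "flux2_h G P W = interp G (\<lambda>\<alpha>. flux2 P (W \<alpha>))"

definition source_h :: "mesh \<Rightarrow> ('s::finite) balance_law \<Rightarrow> (nat \<times> nat \<Rightarrow> real ^ 's) \<Rightarrow> real \<times> real \<Rightarrow> real ^ 's" where
  "source_h G P W = interp G (\<lambda>\<alpha>. source P (W \<alpha>) (point G \<alpha>))"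

definition int_flux1 :: "mesh \<Rightarrow> ('s::finite) balance_law \<Rightarrow> (nat \<times> nat \<Rightarrow> real ^ 's) \<Rightarrow> real \<times> real \<Rightarrow> real ^ 's" where
  "int_flux1 G P W = interp G (\<lambda>\<alpha>. case point G \<alpha> of (a, b) \<Rightarrow>
     integral {start (ax2 G)..b} (\<lambda>\<eta>. flux1_h G P W (a, \<eta>)))"

definition int_flux2 :: "mesh \<Rightarrow> ('s::finite) balance_law \<Rightarrow> (nat \<times> nat \<Rightarrow> real ^ 's) \<Rightarrow> real \<times> real \<Rightarrow> real ^ 's" where
  "int_flux2 G P W = interp G (\<lambda>\<alpha>. case point G \<alpha> of (a, b) \<Rightarrow>
     integral {start (ax1 G)..a} (\<lambda>\<xi>. flux2_h G P W (\<xi>, b)))"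

definition int_source :: "mesh \<Rightarrow> ('s::finite) balance_law \<Rightarrow> (nat \<times> nat \<Rightarrow> real ^ 's) \<Rightarrow> real \<times> real \<Rightarrow> real ^ 's" where
  "int_source G P W = interp G (\<lambda>\<alpha>. case point G \<alpha> of (a, b) \<Rightarrow>
     - integral {start (ax1 G)..a} (\<lambda>\<xi>. integral {start (ax2 G)..b} (\<lambda>\<eta>. source_h G P W (\<xi>, \<eta>))))"

definition global_flux :: "mesh \<Rightarrow> ('s::finite) balance_law \<Rightarrow> (nat \<times> nat \<Rightarrow> real ^ 's) \<Rightarrow> real \<times> real \<Rightarrow> real ^ 's" where
  "global_flux G P W x = int_flux1 G P W x + int_flux2 G P W x + int_source G P W x"


section \<open>The semi-discrete method\<close>

text \<open>The matrix \<open>\<nabla>\<phi>\<^sub>\<alpha> \<cdot> J \<tau>\<close> at the local node \<open>(p, q)\<close> of element \<open>(i, j)\<close>.\<close>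

definition stream_matrix :: "mesh \<Rightarrow> ('s::finite) balance_law \<Rightarrow> (nat \<times> nat \<Rightarrow> real ^ 's) \<Rightarrow>
    nat \<times> nat \<Rightarrow> nat \<Rightarrow> nat \<Rightarrow> nat \<Rightarrow> nat \<Rightarrow> real ^ 's ^ 's" where
  "stream_matrix G P W \<alpha> i j p q =
    (let x = elem_point G i j p q; w = W (elem_index G i j p q); T = tau P (interp G W) i j x in
       elem_dx1 G i (basis G \<alpha>) x *\<^sub>R (jacobian (flux1 P) (at w) ** T) +
       elem_dx2 G j (basis G \<alpha>) x *\<^sub>R (jacobian (flux2 P) (at w) ** T))"

definition R_h :: "mesh \<Rightarrow> ('s::finite) balance_law \<Rightarrow> (nat \<times> nat \<Rightarrow> real ^ 's) \<Rightarrow> nat \<times> nat \<Rightarrow> real ^ 's" where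
  "R_h G P W \<alpha> = quad G (\<lambda>i j p q. let x = elem_point G i j p q in
     basis G \<alpha> x *\<^sub>R elem_dx12 G i j (global_flux G P W) x)"

definition ST_h :: "mesh \<Rightarrow> ('s::finite) balance_law \<Rightarrow> (nat \<times> nat \<Rightarrow> real ^ 's) \<Rightarrow> nat \<times> nat \<Rightarrow> real ^ 's" where
  "ST_h G P W \<alpha> = quad G (\<lambda>i j p q.
     stream_matrix G P W \<alpha> i j p q *v elem_dx12 G i j (global_flux G P W) (elem_point G i j p q))"

definition time_term :: "mesh \<Rightarrow> ('s::finite) balance_law \<Rightarrow> (nat \<times> nat \<Rightarrow> real ^ 's) \<Rightarrow>
    (nat \<times> nat \<Rightarrow> real ^ 's) \<Rightarrow> nat \<times> nat \<Rightarrow> real ^ 's" where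
  "time_term G P W W' \<alpha> = quad G (\<lambda>i j p q.
     let x = elem_point G i j p q; d = interp G W' x in
       basis G \<alpha> x *\<^sub>R d + stream_matrix G P W \<alpha> i j p q *v d)"

definition semi_discrete_solution ::
    "mesh \<Rightarrow> ('s::finite) balance_law \<Rightarrow> real set \<Rightarrow> (real \<Rightarrow> real \<times> real \<Rightarrow> real ^ 's) \<Rightarrow> bool" where
  "semi_discrete_solution G P I u \<longleftrightarrow>
    (\<forall>t\<in>I. u t \<in> fe_space_vec G) \<and>
    (\<forall>t\<in>I. \<exists>W'. (\<forall>\<alpha>\<in>nodes G.
        ((\<lambda>s. nodal_values G (u s) \<alpha>) has_vector_derivative W' \<alpha>) (at t within I)) \<and>
      (\<forall>\<alpha>\<in>nodes G. time_term G P (nodal_values G (u t)) W' \<alpha> +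
        R_h G P (nodal_values G (u t)) \<alpha> + ST_h G P (nodal_values G (u t)) \<alpha> = 0))"


section \<open>Deferred Correction\<close>

definition mass :: "mesh \<Rightarrow> nat \<times> nat \<Rightarrow> nat \<times> nat \<Rightarrow> real" where
  "mass G \<alpha> \<beta> = quad G (\<lambda>i j p q. let x = elem_point G i j p q in basis G \<alpha> x * basis G \<beta> x)"

definition mass_SU :: "mesh \<Rightarrow> ('s::finite) balance_law \<Rightarrow> (nat \<times> nat \<Rightarrow> real ^ 's) \<Rightarrow>
    nat \<times> nat \<Rightarrow> nat \<times> nat \<Rightarrow> real ^ 's ^ 's" where
  "mass_SU G P W \<alpha> \<beta> = quad G (\<lambda>i j p q.
     basis G \<beta> (elem_point G i j p q) *\<^sub>R stream_matrix G P W \<alpha> i j p q)"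

text \<open>The two-sided inverse of a square matrix whose rows and columns are indexed by \<open>A\<close>;
  only its entries in \<open>A \<times> A\<close> matter.\<close>

definition inverse_on :: "'i set \<Rightarrow> ('i \<Rightarrow> 'i \<Rightarrow> real) \<Rightarrow> 'i \<Rightarrow> 'i \<Rightarrow> real" where
  "inverse_on A M = (SOME B. \<forall>\<alpha>\<in>A. \<forall>\<beta>\<in>A.
     (\<Sum>\<gamma>\<in>A. M \<alpha> \<gamma> * B \<gamma> \<beta>) = of_bool (\<alpha> = \<beta>) \<and>
     (\<Sum>\<gamma>\<in>A. B \<alpha> \<gamma> * M \<gamma> \<beta>) = of_bool (\<alpha> = \<beta>))"

definition dec_theta :: "nat \<Rightarrow> (nat \<Rightarrow> real) \<Rightarrow> nat \<Rightarrow> nat \<Rightarrow> real" where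
  "dec_theta M t m r = 1 / (t M - t 0) * integral {t 0..t m} (lagrange_basis M t r)"

text \<open>\<open>dec_iter G P M t Wn k m\<close> is the \<open>k\<close>-th iterate at the subtime node \<open>t m\<close>.\<close>

primrec dec_iter :: "mesh \<Rightarrow> ('s::finite) balance_law \<Rightarrow> nat \<Rightarrow> (nat \<Rightarrow> real) \<Rightarrow>
    (nat \<times> nat \<Rightarrow> real ^ 's) \<Rightarrow> nat \<Rightarrow> nat \<Rightarrow> nat \<times> nat \<Rightarrow> real ^ 's" where
  "dec_iter G P M t Wn 0 = (\<lambda>m. Wn)"
| "dec_iter G P M t Wn (Suc k) =
    (let V = dec_iter G P M t Wn k;
         V' = (\<lambda>r \<beta>. vector_derivative (\<lambda>s. \<Sum>m\<le>M. lagrange_basis M t m s *\<^sub>R V m \<beta>) (at (t r)));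
         Y = (\<lambda>r \<beta>. (\<Sum>\<gamma>\<in>nodes G. mass_SU G P (V r) \<beta> \<gamma> *v V' r \<gamma>) +
                R_h G P (V r) \<beta> + ST_h G P (V r) \<beta>)
     in (\<lambda>m \<alpha>. if m = 0 then Wn \<alpha>
          else Wn \<alpha> - (t M - t 0) *\<^sub>R (\<Sum>r\<le>M. dec_theta M t m r *\<^sub>R
            (\<Sum>\<beta>\<in>nodes G. inverse_on (nodes G) (mass G) \<alpha> \<beta> *\<^sub>R Y r \<beta>))))"

definition dec_step :: "mesh \<Rightarrow> ('s::finite) balance_law \<Rightarrow> nat \<Rightarrow> (nat \<Rightarrow> real) \<Rightarrow> nat \<Rightarrow>
    (nat \<times> nat \<Rightarrow> real ^ 's) \<Rightarrow> nat \<times> nat \<Rightarrow> real ^ 's" where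
  "dec_step G P M t \<kappa> Wn = dec_iter G P M t Wn \<kappa> M"


section \<open>Discrete stationary solutions\<close>

definition semi_discrete_stationary ::
    "mesh \<Rightarrow> ('s::finite) balance_law \<Rightarrow> (real \<times> real \<Rightarrow> real ^ 's) \<Rightarrow> bool" where
  "semi_discrete_stationary G P u \<longleftrightarrow>
    (\<forall>\<alpha>\<in>nodes G. R_h G P (nodal_values G u) \<alpha> = 0 \<and> ST_h G P (nodal_values G u) \<alpha> = 0) \<and>
    semi_discrete_solution G P UNIV (\<lambda>t. u)"

definition dec_stationary ::
    "mesh \<Rightarrow> ('s::finite) balance_law \<Rightarrow> nat \<Rightarrow> (nat \<Rightarrow> real) \<Rightarrow> nat \<Rightarrow> (real \<times> real \<Rightarrow> real ^ 's) \<Rightarrow> bool" where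
  "dec_stationary G P M t \<kappa> u \<longleftrightarrow>
    (\<forall>\<alpha>\<in>nodes G. dec_step G P M t \<kappa> (nodal_values G u) \<alpha> = nodal_values G u \<alpha>)"

end

theory Submission
  imports Defs
begin

text \<open>The Lagrange bases form a partition of unity, so the interpolant of nodal data
  \<open>u a + w b\<close> is again a sum of two univariate functions. The mixed derivative of such a sum
  vanishes on every element; since the global flux enters \<open>R_h\<close> and \<open>ST_h\<close> only through this
  derivative, both residuals are zero, and every Deferred Correction iterate equals the initial
  state.\<close>

section \<open>Partition of unity and interpolation of separable data\<close>

text \<open>The sum minus 1 is a polynomial of degree at most \<open>n\<close> with
  \<open>n + 1\<close> distinct roots \<open>y r\<close>, hence zero. It serves both in space, on
  each cell, and in time, for the subtime nodes.\<close>

lemma sum_lagrange_basis: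
  assumes y: "strict_mono_on {..n} y"
  shows "(\<Sum>r\<le>n. lagrange_basis n y r t) = 1"
proof -
  define L where "L r = (\<Prod>l\<in>{..n} - {r}. [:- y l / (y r - y l), 1 / (y r - y l):])" for r
  have L: "poly (L r) s = lagrange_basis n y r s" for r s
    by (simp add: L_def lagrange_basis_def poly_prod diff_divide_distrib)
  define p where "p = (\<Sum>r\<le>n. L r) - 1"
  have "degree (L r) \<le> n" if "r \<le> n" for r
  proof -
    have "degree (L r) \<le> (\<Sum>l\<in>{..n} - {r}. degree [:- y l / (y r - y l), 1 / (y r - y l):])"
      unfolding L_def by (rule order_trans[OF degree_prod_sum_le]) (auto simp: comp_def)
    also have "\<dots> \<le> (\<Sum>l\<in>{..n} - {r}. 1)"
      by (intro sum_mono) simp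
    also have "\<dots> = n"
      using that by simp
    finally show ?thesis .
  qed
  then have deg: "degree p \<le> n"
    unfolding p_def by (intro degree_diff_le degree_sum_le) auto
  have "inj_on y {..n}"
    using y by (rule strict_mono_on_imp_inj_on)
  then have card: "card (y ` {..n}) = Suc n"
    by (simp add: card_image)
  have roots: "y ` {..n} \<subseteq> {x. poly p x = 0}"
  proof clarsimp
    fix m assume m: "m \<le> n"
    have "(\<Sum>r\<le>n. lagrange_basis n y r (y m)) = (\<Sum>r\<le>n. of_bool (r = m))"
      by (intro sum.cong refl lagrange_basis_delta[OF y _ m]) simp
    also have "\<dots> = 1"
      using m by (simp add: of_bool_def)
    finally show "poly p (y m) = 0"
      by (simp add: p_def poly_sum L)
  qed
  have "p = 0"
  proof (rule ccontr)
    assume nz: "p \<noteq> 0"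
    have "Suc n \<le> card {x. poly p x = 0}"
      unfolding card[symmetric] using nz roots by (intro card_mono poly_roots_finite)
    then show False
      using card_poly_roots_bound[OF nz] deg by simp
  qed
  then have "poly p t = 0"
    by simp
  then show ?thesis
    by (simp add: p_def poly_sum L)
qed

text \<open>At \<open>x\<close> only the functions of the cell \<open>cell_of X x\<close> survive,
  and they form a Lagrange basis. The point \<open>x\<close> may be any real: \<open>cell_of\<close>
  always returns a valid cell, and the Lagrange identity holds on the whole line.\<close>

lemma sum_basis1:
  assumes X: "valid_axis X" and K: "K \<ge> 1"
  shows "(\<Sum>a\<le>cells X * K. basis1 K X a x) = 1"
proof -
  define i where "i = cell_of X x"
  let ?L = "lagrange_basis K (cell_node K X i)"
  have "i < cells X"
    using X by (auto simp: i_def cell_of_def valid_axis_def)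
  then have "Suc i * K \<le> cells X * K"
    by (intro mult_right_mono) auto
  then have sub: "{i * K..Suc i * K} \<subseteq> {..cells X * K}"
    by auto
  have "(\<Sum>a\<le>cells X * K. basis1 K X a x) = (\<Sum>a\<in>{i * K..Suc i * K}. ?L (a - i * K) x)"
    by (rule sum.mono_neutral_cong_right[OF _ sub])
       (auto simp: basis1_def Let_def i_def[symmetric])
  \<comment> \<open>The bounds are rewritten only to match the index shift by
    \<open>i * K\<close>.\<close>
  also have "\<dots> = (\<Sum>p\<in>{0 + i * K..K + i * K}. ?L (p - i * K) x)"
    by simp
  also have "\<dots> = (\<Sum>p\<le>K. ?L p x)"
    unfolding sum.shift_bounds_cl_nat_ivl by (simp add: atLeast0AtMost)
  finally show ?thesis
    using sum_lagrange_basis[OF cell_node_mono[OF X K]] by simp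
qed

text \<open>Each summand is constant in one direction, where the basis functions sum to 1, so a
  one-dimensional interpolant remains.\<close>

lemma interp_separable:
  assumes "valid_mesh G"
  shows "interp G (\<lambda>(a, b). u a + w b) x =
    interp1 (deg G) (ax1 G) u (fst x) + interp1 (deg G) (ax2 G) w (snd x)"
proof -
  let ?A = "{..cells (ax1 G) * deg G}" and ?B = "{..cells (ax2 G) * deg G}"
  let ?b = "\<lambda>a. basis1 (deg G) (ax1 G) a (fst x)" and ?c = "\<lambda>b. basis1 (deg G) (ax2 G) b (snd x)"
  have one: "sum ?b ?A = 1" "sum ?c ?B = 1"
    using assms by (simp_all add: sum_basis1 valid_mesh_def)
  have "interp G (\<lambda>(a, b). u a + w b) x = (\<Sum>a\<in>?A. \<Sum>b\<in>?B. (?b a * ?c b) *\<^sub>R (u a + w b))"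
    by (simp add: interp_def nodes_def basis_def sum.cartesian_product case_prod_unfold)
  \<comment> \<open>The two scalars are nested in opposite orders so that in each double sum the
    factor summing to 1 stands outermost once sums are pulled out.\<close>
  also have "\<dots> = (\<Sum>a\<in>?A. \<Sum>b\<in>?B. ?c b *\<^sub>R ?b a *\<^sub>R u a) + (\<Sum>a\<in>?A. \<Sum>b\<in>?B. ?b a *\<^sub>R ?c b *\<^sub>R w b)"
    by (simp add: scaleR_add_right sum.distrib mult.commute)
  also have "(\<Sum>a\<in>?A. \<Sum>b\<in>?B. ?c b *\<^sub>R ?b a *\<^sub>R u a) = (\<Sum>a\<in>?A. ?b a *\<^sub>R u a)"
    by (simp only: scaleR_sum_left[symmetric] one scaleR_one)
  also have "(\<Sum>a\<in>?A. \<Sum>b\<in>?B. ?b a *\<^sub>R ?c b *\<^sub>R w b) = (\<Sum>b\<in>?B. ?c b *\<^sub>R w b)"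
    by (simp only: scaleR_sum_right[symmetric] scaleR_sum_left[symmetric] one scaleR_one)
  finally show ?thesis
    by (simp add: interp1_def)
qed

lemma interp1_node:
  assumes "valid_axis X" "K \<ge> 1" "a \<le> cells X * K"
  shows "interp1 K X v (node K X a) = v a"
proof -
  have "interp1 K X v (node K X a) = (\<Sum>b\<le>cells X * K. if b = a then v b else 0)"
    unfolding interp1_def using assms by (intro sum.cong refl) (simp add: basis1_delta)
  then show ?thesis
    using assms by simp
qed

lemma interp_point:
  assumes "valid_mesh G" "\<alpha> \<in> nodes G"
  shows "interp G v (point G \<alpha>) = v \<alpha>"
proof -
  have "interp G v (point G \<alpha>) = (\<Sum>\<beta>\<in>nodes G. if \<beta> = \<alpha> then v \<beta> else 0)"
    unfolding interp_def by (intro sum.cong refl) (simp add: basis_delta assms)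
  then show ?thesis
    using assms by (simp add: nodes_def)
qed

lemma interp_add: "interp G u x + interp G v x = interp G (\<lambda>\<alpha>. u \<alpha> + v \<alpha>) x"
  by (simp add: interp_def scaleR_add_right sum.distrib)

section \<open>Node numbering and cell geometry\<close>

lemma node_index_le:
  assumes "i < n" "p \<le> K"
  shows "i * K + p \<le> n * (K::nat)"
proof -
  have "i * K + p \<le> Suc i * K"
    using assms by simp
  also have "\<dots> \<le> n * K"
    using assms by (intro mult_right_mono) auto
  finally show ?thesis .
qed

lemma node_index_cases:
  assumes "a \<le> n * K" "n \<ge> 1" "K \<ge> 1"
  obtains i p where "i < n" "p \<le> K" "a = i * K + (p::nat)"
\<comment> \<open>For the last index \<open>a div K\<close> is \<open>n\<close>, which is not a
  cell; it counts as point \<open>K\<close> of cell \<open>n - 1\<close>.\<close>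
proof (cases "a = n * K")
  case True
  then show ?thesis
    using assms that[of "n - 1" K] by (cases n) auto
next
  case False
  then have "a div K < n"
    using assms by (simp add: less_mult_imp_div_less)
  then show ?thesis
    using assms that[of "a div K" "a mod K"] by (simp add: less_imp_le)
qed

lemma cell_subset:
  assumes X: "valid_axis X" and i: "i < cells X"
  shows "cell X i \<subseteq> {start X..start X + len X}"
proof -
  have "real (Suc i) * step X \<le> real (cells X) * step X"
    using i step_pos[OF X] by (intro mult_right_mono) auto
  also have "\<dots> = len X"
    using X by (simp add: step_def valid_axis_def)
  finally show ?thesis
    using step_pos[OF X] by (auto simp: cell_def vertex_def intro: order_trans[rotated])
qed

section \<open>One-sided derivatives of separable functions\<close>

lemma vector_derivative_const_within_cell:
  assumes "valid_axis X" "x \<in> cell X i" "\<And>y. y \<in> cell X i \<Longrightarrow> h y = c"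
  shows "vector_derivative h (at x within cell X i) = 0"
proof -
  \<comment> \<open>A nondegenerate cell makes the derivative within it unique, also at its end
    points.\<close>
  have lt: "vertex X i < vertex X (Suc i)"
    using step_pos[OF assms(1)] by (simp add: vertex_def algebra_simps)
  have "(h has_vector_derivative 0) (at x within cell X i)"
    by (rule has_vector_derivative_transform[of _ _ h "\<lambda>_. c"]) (use assms in auto)
  then show ?thesis
    using vector_derivative_within_cbox[OF lt] assms(2) by (simp add: cell_def)
qed

text \<open>Where \<open>g\<close> is not differentiable, both sides are the same junk value: adding a constant
  preserves the set of derivatives from which Hilbert choice picks.\<close>

lemma vector_derivative_add_const_cong:
  assumes "x \<in> S" "\<And>y. y \<in> S \<Longrightarrow> h y = c + g y"
  shows "vector_derivative h (at x within S) = vector_derivative g (at x within S)"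
proof -
  have "(h has_vector_derivative d) (at x within S) \<longleftrightarrow>
        (g has_vector_derivative d) (at x within S)" for d
  proof
    assume "(h has_vector_derivative d) (at x within S)"
    then have "((\<lambda>y. h y - c) has_vector_derivative d - 0) (at x within S)"
      by (intro derivative_intros)
    then show "(g has_vector_derivative d) (at x within S)"
      by (auto intro: has_vector_derivative_transform[OF assms(1), rotated] simp: assms(2))
  next
    assume "(g has_vector_derivative d) (at x within S)"
    then have "((\<lambda>y. c + g y) has_vector_derivative 0 + d) (at x within S)"
      by (intro derivative_intros)
    then show "(h has_vector_derivative d) (at x within S)"
      by (auto intro: has_vector_derivative_transform[OF assms(1), rotated] simp: assms(2))
  qed
  then show ?thesis
    by (simp add: vector_derivative_def)
qed

text \<open>For fixed first coordinate \<open>f\<close> contributes only a constant, so the inner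
  derivative is the same all along the first cell, and the outer derivative annihilates it.\<close>

lemma elem_dx12_separable:
  assumes "valid_mesh G" "x \<in> element G i j"
    and sep: "\<And>y. y \<in> element G i j \<Longrightarrow> u y = f (fst y) + g (snd y)"
  shows "elem_dx12 G i j u x = 0"
proof -
  have x: "fst x \<in> cell (ax1 G) i" "snd x \<in> cell (ax2 G) j"
    using assms(2) by (auto simp: element_def)
  \<comment> \<open>The common value stays unevaluated; only its independence of
    \<open>\<xi>\<close> matters.\<close>
  have "elem_dx2 G j u (\<xi>, snd x) = vector_derivative g (at (snd x) within cell (ax2 G) j)"
    if "\<xi> \<in> cell (ax1 G) i" for \<xi>
    unfolding elem_dx2_def fst_conv snd_conv
    by (rule vector_derivative_add_const_cong[of _ _ _ "f \<xi>"])
       (use x that in \<open>auto simp: sep element_def\<close>)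
  then show ?thesis
    unfolding elem_dx12_def elem_dx1_def[of G i "elem_dx2 G j u"]
    using assms(1) x by (intro vector_derivative_const_within_cell) (auto simp: valid_mesh_def)
qed

section \<open>Local and global nodes\<close>

lemma elem_point_in_element:
  assumes "valid_mesh G" "p \<le> deg G" "q \<le> deg G"
  shows "elem_point G i j p q \<in> element G i j"
  using assms by (auto simp: elem_point_def element_def valid_mesh_def intro: cell_node_in_cell)

lemma element_subset_domain:
  assumes "valid_mesh G" "i < cells (ax1 G)" "j < cells (ax2 G)"
  shows "element G i j \<subseteq> domain G"
  unfolding element_def domain_def
  using assms by (intro Sigma_mono cell_subset) (auto simp: valid_mesh_def)

lemma elem_point_eq_point:
  assumes "valid_mesh G" "p \<le> deg G" "q \<le> deg G"
  shows "elem_point G i j p q = point G (elem_index G i j p q)"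
  using assms
  by (simp add: elem_point_def point_def elem_index_def node_eq_cell_node valid_mesh_def)

lemma elem_index_in_nodes:
  assumes "i < cells (ax1 G)" "j < cells (ax2 G)" "p \<le> deg G" "q \<le> deg G"
  shows "elem_index G i j p q \<in> nodes G"
  using assms by (simp add: elem_index_def nodes_def node_index_le)

text \<open>This carries element-wise nodal identities over to global indices. A node on an
  interface has several representations, and any of them will do.\<close>

lemma nodes_cases:
  assumes "valid_mesh G" "\<alpha> \<in> nodes G"
  obtains i j p q where "i < cells (ax1 G)" "j < cells (ax2 G)" "p \<le> deg G" "q \<le> deg G"
    "\<alpha> = elem_index G i j p q"
proof -
  have le: "fst \<alpha> \<le> cells (ax1 G) * deg G" "snd \<alpha> \<le> cells (ax2 G) * deg G"
    and pos: "cells (ax1 G) \<ge> 1" "cells (ax2 G) \<ge> 1" "deg G \<ge> 1"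
    using assms by (auto simp: nodes_def valid_mesh_def valid_axis_def)
  obtain i p where "i < cells (ax1 G)" "p \<le> deg G" "fst \<alpha> = i * deg G + p"
    using node_index_cases[OF le(1) pos(1,3)] .
  moreover obtain j q where "j < cells (ax2 G)" "q \<le> deg G" "snd \<alpha> = j * deg G + q"
    using node_index_cases[OF le(2) pos(2,3)] .
  ultimately show ?thesis
    using that[of i j p q] by (simp add: elem_index_def prod_eq_iff)
qed

lemma quad_zero:
  assumes "\<And>i j p q. \<lbrakk>i < cells (ax1 G); j < cells (ax2 G); p \<le> deg G; q \<le> deg G\<rbrakk> \<Longrightarrow> v i j p q = 0"
  shows "quad G v = 0"
  unfolding quad_def quad_elem_def using assms by (intro sum.neutral ballI) simp

text \<open>From left to right, the one-dimensional interpolants reproduce their nodal values.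
  Conversely, the nodal identities determine the data \<open>v\<close> on all nodes, and
  \<open>interp_separable\<close> then applies.\<close>

lemma interp_separable_iff_nodal:
  assumes G: "valid_mesh G"
  shows "(\<forall>x\<in>domain G. interp G v x =
      interp1 (deg G) (ax1 G) (\<lambda>a. f (node (deg G) (ax1 G) a)) (fst x) +
      interp1 (deg G) (ax2 G) (\<lambda>b. g (node (deg G) (ax2 G) b)) (snd x)) \<longleftrightarrow>
    (\<forall>i<cells (ax1 G). \<forall>j<cells (ax2 G). \<forall>p\<le>deg G. \<forall>k\<le>deg G. interp G v (elem_point G i j p k) =
      f (cell_node (deg G) (ax1 G) i p) + g (cell_node (deg G) (ax2 G) j k))"
    (is "?L \<longleftrightarrow> ?R")
proof
  assume L: ?L
  show ?R
  proof (intro allI impI)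
    fix i j p k assume *: "i < cells (ax1 G)" "j < cells (ax2 G)" "p \<le> deg G" "k \<le> deg G"
    have X: "valid_axis (ax1 G)" "valid_axis (ax2 G)" and K: "deg G \<ge> 1"
      using G by (auto simp: valid_mesh_def)
    let ?x = "elem_point G i j p k"
    have x: "fst ?x = node (deg G) (ax1 G) (i * deg G + p)" "snd ?x = node (deg G) (ax2 G) (j * deg G + k)"
      using * K by (simp_all add: elem_point_def node_eq_cell_node)
    have "?x \<in> domain G"
      using elem_point_in_element[OF G] element_subset_domain[OF G] * by blast
    from L[rule_format, OF this]
    have "interp G v ?x = f (fst ?x) + g (snd ?x)"
      unfolding x using * by (simp only: interp1_node[OF X(1) K] interp1_node[OF X(2) K] node_index_le)
    then show "interp G v ?x = f (cell_node (deg G) (ax1 G) i p) + g (cell_node (deg G) (ax2 G) j k)"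
      by (simp add: elem_point_def)
  qed
next
  assume R: ?R
  have v: "v \<alpha> = f (node (deg G) (ax1 G) (fst \<alpha>)) + g (node (deg G) (ax2 G) (snd \<alpha>))"
    if \<alpha>_node: "\<alpha> \<in> nodes G" for \<alpha>
  proof -
    obtain i j p q where *: "i < cells (ax1 G)" "j < cells (ax2 G)" "p \<le> deg G" "q \<le> deg G"
      and \<alpha>: "\<alpha> = elem_index G i j p q"
      using nodes_cases[OF G \<alpha>_node] .
    have "v \<alpha> = interp G v (elem_point G i j p q)"
      by (simp only: elem_point_eq_point[OF G *(3,4)] interp_point[OF G \<alpha>_node] \<alpha>[symmetric])
    also have "\<dots> = f (fst (elem_point G i j p q)) + g (snd (elem_point G i j p q))"
      using R * by (simp add: elem_point_def)
    finally show ?thesis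
      unfolding elem_point_eq_point[OF G *(3,4)] by (simp add: point_def \<alpha>)
  qed
  \<comment> \<open>Only the values of \<open>v\<close> on \<open>nodes G\<close> enter the
    interpolant.\<close>
  have "interp G v = interp G (\<lambda>(a, b). f (node (deg G) (ax1 G) a) + g (node (deg G) (ax2 G) b))"
    unfolding interp_def by (rule ext, rule sum.cong) (simp_all add: v case_prod_unfold)
  then show ?L
    by (simp add: interp_separable[OF G])
qed

section \<open>Vanishing residuals and stationarity\<close>

text \<open>Both quadratures sample the mixed derivative only at local nodes, which lie in closed
  elements inside the domain.\<close>

lemma residuals_zero:
  assumes G: "valid_mesh G"
    and sep: "\<And>x. x \<in> domain G \<Longrightarrow> global_flux G P W x = f (fst x) + g (snd x)"
  shows "R_h G P W \<alpha> = 0" and "ST_h G P W \<alpha> = 0"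
proof -
  have "elem_dx12 G i j (global_flux G P W) (elem_point G i j p q) = 0"
    if *: "i < cells (ax1 G)" "j < cells (ax2 G)" "p \<le> deg G" "q \<le> deg G" for i j p q
    using element_subset_domain[OF G *(1,2)]
    by (intro elem_dx12_separable[where f = f and g = g, OF G elem_point_in_element[OF G *(3,4)]] sep) blast
  then show "R_h G P W \<alpha> = 0" and "ST_h G P W \<alpha> = 0"
    unfolding R_h_def ST_h_def by (auto intro!: quad_zero simp: Let_def)
qed

lemma time_term_zero: "time_term G P W (\<lambda>_. 0) \<alpha> = 0"
  unfolding time_term_def by (rule quad_zero) (simp add: interp_def Let_def)

text \<open>If all subtime values of an iterate equal \<open>Wn\<close>, its interpolant in time is
  constant, so the term with \<open>mass_SU\<close> vanishes along with the residuals and the next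
  correction is zero.\<close>

lemma dec_iter_stationary:
  assumes t: "strict_mono_on {..M} t"
    and res: "\<And>\<alpha>. R_h G P Wn \<alpha> = 0" "\<And>\<alpha>. ST_h G P Wn \<alpha> = 0"
  shows "dec_iter G P M t Wn k = (\<lambda>m. Wn)"
proof (induction k)
  case (Suc k)
  have "(\<lambda>s. \<Sum>m\<le>M. lagrange_basis M t m s *\<^sub>R Wn \<beta>) = (\<lambda>s. Wn \<beta>)" for \<beta>
    by (simp add: scaleR_sum_left[symmetric] sum_lagrange_basis[OF t])
  then show ?case
    by (simp add: Suc.IH Let_def res fun_eq_iff)
qed simp

theorem proposition10:
  fixes G :: mesh
    and P :: "('s::finite) balance_law"
    and f g :: "real \<Rightarrow> real ^ 's"
    and W\<^sub>h :: "real \<times> real \<Rightarrow> real ^ 's"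
  defines "W \<equiv> nodal_values G W\<^sub>h"
    and "f\<^sub>h \<equiv> interp1 (deg G) (ax1 G) (\<lambda>a. f (node (deg G) (ax1 G) a))"
    and "g\<^sub>h \<equiv> interp1 (deg G) (ax2 G) (\<lambda>b. g (node (deg G) (ax2 G) b))"
  assumes "valid_mesh G"
    and "W\<^sub>h \<in> fe_space_vec G"
    and "\<forall>\<alpha>\<in>nodes G. flux1 P differentiable at (W \<alpha>) \<and> flux2 P differentiable at (W \<alpha>)"
  shows "((\<forall>x\<in>domain G. int_flux1 G P W x + int_flux2 G P W x + int_source G P W x
              = f\<^sub>h (fst x) + g\<^sub>h (snd x))
          \<longleftrightarrow>
          (\<forall>i<cells (ax1 G). \<forall>j<cells (ax2 G). \<forall>p\<le>deg G. \<forall>k\<le>deg G.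
              int_flux1 G P W (elem_point G i j p k) + int_flux2 G P W (elem_point G i j p k)
                + int_source G P W (elem_point G i j p k)
              = f (cell_node (deg G) (ax1 G) i p) + g (cell_node (deg G) (ax2 G) j k)))
        \<and>
        ((\<forall>x\<in>domain G. int_flux1 G P W x + int_flux2 G P W x + int_source G P W x
              = f\<^sub>h (fst x) + g\<^sub>h (snd x))
          \<longrightarrow> semi_discrete_stationary G P W\<^sub>h \<and>
              (\<forall>M t \<kappa>. M \<ge> 1 \<longrightarrow> strict_mono_on {..M} t \<longrightarrow> dec_stationary G P M t \<kappa> W\<^sub>h))"
proof -
  note G = assms(4)
  \<comment> \<open>All three terms are nodal interpolants, so their sum is a single one and
    \<open>interp_separable_iff_nodal\<close> becomes applicable.\<close>
  obtain v where v: "\<And>x. int_flux1 G P W x + int_flux2 G P W x + int_source G P W x = interp G v x"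
    unfolding int_flux1_def int_flux2_def int_source_def interp_add by blast
  have stationary: "semi_discrete_stationary G P W\<^sub>h \<and>
      (\<forall>M t \<kappa>. M \<ge> 1 \<longrightarrow> strict_mono_on {..M} t \<longrightarrow> dec_stationary G P M t \<kappa> W\<^sub>h)"
    if "\<forall>x\<in>domain G. int_flux1 G P W x + int_flux2 G P W x + int_source G P W x
          = f\<^sub>h (fst x) + g\<^sub>h (snd x)"
  proof -
    \<comment> \<open>The univariate functions used here are the interpolants
      \<open>f\<^sub>h\<close> and \<open>g\<^sub>h\<close>, which describe the global flux on the
      whole domain.\<close>
    have res: "R_h G P W \<alpha> = 0" "ST_h G P W \<alpha> = 0" for \<alpha>
      using that by (auto intro!: residuals_zero[OF G] simp: global_flux_def)
    \<comment> \<open>The witness zero is the time derivative of the nodal values of the constant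
      state.\<close>
    have "semi_discrete_stationary G P W\<^sub>h"
      using assms(5) res unfolding semi_discrete_stationary_def semi_discrete_solution_def W_def
      by (auto intro!: exI[of _ "\<lambda>_. 0"] simp: time_term_zero)
    then show ?thesis
      using res unfolding dec_stationary_def dec_step_def W_def by (simp add: dec_iter_stationary)
  qed
  show ?thesis
    using stationary unfolding v f\<^sub>h_def g\<^sub>h_def interp_separable_iff_nodal[OF G] by blast
qed

end
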